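(* Let $n\ge2$, $q\ge2$, $s\ge1$ be integers and let $C\subseteq[q]^n$ be a $(2s-1)$-design with degree $s$ in $H(n,q)$ that is not tight, with degree set $\{\alpha_1,\ldots,\alpha_s\}$. Then \[ q^s\left(\frac{q^{s(s-1)/2}\prod_{1\le i<j\le s}(\alpha_i-\alpha_j)}{\prod_{i=1}^{s-1}i!}\right)^2 \] is an integer dividing $|C|^{2s}$.
   Context: $[q]=\{1,\ldots,q\}$; $\partial$ is Hamming distance. A nonempty $C\subseteq[q]^n$ is a $t$-design in the Hamming scheme $H(n,q)$ if the array of its elements (as rows) is an orthogonal array of strength $t$: in any $t$ columns every element of $[q]^t$ occurs equally often. Its degree set is $\{\partial(x,y):x,y\in C,x\ne y\}$ and its degree is the size of that set. A $(2s-1)$-design is tight if $|C|=\sum_{k=0}^{s-1}\binom{n}{k}(q-1)^k+\binom{n-1}{s-1}(q-1)^s$. *)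

theory Defs
  imports Complex_Main "HOL-Library.FuncSet"
begin

text \<open>Words of length \<open>n\<close> over \<open>[q]\<close> are extensional functions from the set of coordinates
  \<open>{1..n}\<close> to \<open>{1..q}\<close>.\<close>

definition words :: "nat \<Rightarrow> nat \<Rightarrow> (nat \<Rightarrow> nat) set" where
  "words n q = {1..n} \<rightarrow>\<^sub>E {1..q}"

definition hamming_dist :: "nat \<Rightarrow> (nat \<Rightarrow> nat) \<Rightarrow> (nat \<Rightarrow> nat) \<Rightarrow> nat" where
  "hamming_dist n x y = card {i \<in> {1..n}. x i \<noteq> y i}"

text \<open>The strength \<open>t\<close> of an orthogonal array is at most its number \<open>n\<close> of columns; without
  \<open>t \<le> n\<close> the condition on column sets would be vacuous for \<open>t > n\<close>.\<close>

definition hamming_design :: "nat \<Rightarrow> nat \<Rightarrow> nat \<Rightarrow> (nat \<Rightarrow> nat) set \<Rightarrow> bool" where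
  "hamming_design n q t C \<longleftrightarrow>
     C \<noteq> {} \<and> C \<subseteq> words n q \<and> t \<le> n \<and>
     (\<forall>T. T \<subseteq> {1..n} \<and> card T = t \<longrightarrow>
        (\<exists>m::nat. \<forall>w \<in> T \<rightarrow>\<^sub>E {1..q}. card {x \<in> C. restrict x T = w} = m))"

definition degree_set :: "nat \<Rightarrow> (nat \<Rightarrow> nat) set \<Rightarrow> nat set" where
  "degree_set n C = {hamming_dist n x y | x y. x \<in> C \<and> y \<in> C \<and> x \<noteq> y}"

definition code_degree :: "nat \<Rightarrow> (nat \<Rightarrow> nat) set \<Rightarrow> nat" where
  "code_degree n C = card (degree_set n C)"

definition tight_odd_design :: "nat \<Rightarrow> nat \<Rightarrow> nat \<Rightarrow> (nat \<Rightarrow> nat) set \<Rightarrow> bool" where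
  "tight_odd_design n q s C \<longleftrightarrow>
     hamming_design n q (2 * s - 1) C \<and>
     card C = (\<Sum>k = 0..s - 1. (n choose k) * (q - 1) ^ k) + ((n - 1) choose (s - 1)) * (q - 1) ^ s"

end

theory Submission imports Defs "Jordan_Normal_Form.Determinant"
begin

text \<open>
  The words of \<open>C\<close> with first letter \<open>1\<close> form a \<open>(2s-2)\<close>-design \<open>X\<close> in \<open>H(n-1,q)\<close> with
  \<open>M = |C|/q\<close> elements, all of whose distances are among the \<open>\<alpha>\<^sub>i\<close>. On \<open>X\<close> the matrices
  \<open>E\<^sub>k = K\<^sub>k(\<partial>(x,y))/M\<close> for \<open>k < s\<close>, with \<open>K\<^sub>k\<close> the Krawtchouk polynomials of \<open>H(n-1,q)\<close>, are
  nonzero mutually orthogonal idempotents, and \<open>1 - \<Sum>E\<^sub>k\<close> is nonzero because \<open>C\<close> is not tight.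
  If \<open>c\<close> denotes the inverse of the matrix \<open>(K\<^sub>k(\<alpha>\<^sub>i))\<close>, then the 0/1 matrix of the relation
  \<open>\<partial>(x,y) = \<alpha>\<^sub>i\<close> is \<open>M \<Sum> c\<^sub>i\<^sub>k E\<^sub>k\<close> minus a scalar \<open>L\<^sub>i\<close>, so it has the rational eigenvalues
  \<open>M c\<^sub>i\<^sub>k - L\<^sub>i\<close> and \<open>- L\<^sub>i\<close>, which must be integers. Hence \<open>M c\<close> is integral and the integer
  \<open>det (K\<^sub>k(\<alpha>\<^sub>i))\<close> divides \<open>M\<^sup>s\<close>. This determinant is of Vandermonde type and equals the quantity
  that is squared in the theorem.
\<close>

section \<open>Determinants of Vandermonde type\<close>

text \<open>The matrix of \<open>g\<close> factors as a lower triangular matrix with diagonal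
  \<open>a u u\<close> times the matrix of \<open>f\<close>. This serves both basis changes below:
  Krawtchouk polynomials to binomials, and binomials to Newton polynomials.\<close>

lemma det_lower_triangular_combination:
  fixes f g :: "nat \<Rightarrow> nat \<Rightarrow> 'a::idom"
  assumes "\<And>u l. u < m \<Longrightarrow> l < m \<Longrightarrow> g u l = (\<Sum>v\<le>u. a u v * f v l)"
  shows "det (mat m m (\<lambda>(u, l). g u l)) = (\<Prod>u<m. a u u) * det (mat m m (\<lambda>(u, l). f u l))"
proof -
  let ?A = "mat m m (\<lambda>(u, v). if v \<le> u then a u v else 0)"
  let ?F = "mat m m (\<lambda>(u, l). f u l)"
  have "mat m m (\<lambda>(u, l). g u l) = ?A * ?F"
  proof (rule eq_matI)
    fix u l assume "u < dim_row (?A * ?F)" "l < dim_col (?A * ?F)"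
    then have ul: "u < m" "l < m"
      by auto
    have "(\<Sum>v<m. (if v \<le> u then a u v else 0) * f v l) = (\<Sum>v\<in>{v\<in>{..<m}. v \<le> u}. a u v * f v l)"
      by (subst sum.inter_filter) (auto intro: sum.cong)
    also have "{v\<in>{..<m}. v \<le> u} = {..u}"
      using ul by auto
    finally show "mat m m (\<lambda>(u, l). g u l) $$ (u, l) = (?A * ?F) $$ (u, l)"
      using ul assms by (simp add: scalar_prod_def lessThan_atLeast0)
  qed auto
  moreover have "det ?A = (\<Prod>u<m. a u u)"
    by (subst det_lower_triangular[of m])
       (auto simp: prod_list_diag_prod lessThan_atLeast0)
  ultimately show ?thesis
    by (simp add: det_mult[of _ m])
qed

text \<open>The Newton interpolation basis with nodes \<open>b\<close>: evaluated at the nodes it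
  gives a triangular matrix.\<close>

definition newton :: "(nat \<Rightarrow> 'a::comm_ring_1) \<Rightarrow> nat \<Rightarrow> 'a \<Rightarrow> 'a" where
  "newton b v x = (\<Prod>w<v. x - b w)"

lemma gchoose_newton_expansion:
  fixes b :: "nat \<Rightarrow> 'a::field_char_0"
  shows "\<exists>a. a u = 1 / fact u \<and> (\<forall>x. x gchoose u = (\<Sum>v\<le>u. a v * newton b v x))"
proof (induction u)
  case 0
  then show ?case
    by (intro exI[of _ "\<lambda>_. 1"]) (simp add: newton_def)
next
  case (Suc u)
  then obtain a where a: "a u = 1 / fact u" "\<And>x. x gchoose u = (\<Sum>v\<le>u. a v * newton b v x)"
    by blast
  \<comment> \<open>From \<open>(u + 1) * (x gchoose (u + 1)) = (x - u) * (x gchoose u)\<close> and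
    \<open>x - u = (x - b v) + (b v - u)\<close>: the first summand raises the Newton index by one,
    the second keeps it. The guards make the terms at the ends \<open>v = 0\<close> and
    \<open>v = Suc u\<close> vanish.\<close>
  define c where "c v = ((if v = 0 then 0 else a (v - 1)) + (if v \<le> u then a v * (b v - of_nat u) else 0))
      / of_nat (Suc u)" for v
  have "x gchoose Suc u = (\<Sum>v\<le>Suc u. c v * newton b v x)" for x
  proof -
    have "of_nat (Suc u) * (x gchoose Suc u) = (x - of_nat u) * (x gchoose u)"
      using gbinomial_mult_1[of x u] by (simp add: algebra_simps)
    also have "\<dots> = (\<Sum>v\<le>u. a v * newton b (Suc v) x + a v * (b v - of_nat u) * newton b v x)"
      unfolding a by (simp add: sum_distrib_left newton_def algebra_simps)
    also have "\<dots> = (\<Sum>v\<le>Suc u. (if v = 0 then 0 else a (v - 1)) * newton b v x) +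
        (\<Sum>v\<le>Suc u. (if v \<le> u then a v * (b v - of_nat u) else 0) * newton b v x)"
      by (subst sum.atMost_Suc_shift) (simp add: sum.distrib)
    also have "\<dots> = of_nat (Suc u) * (\<Sum>v\<le>Suc u. c v * newton b v x)"
      unfolding c_def sum_distrib_left sum.distrib[symmetric]
      by (intro sum.cong refl) (simp add: field_simps del: of_nat_Suc)
    finally show ?thesis
      by (simp del: of_nat_Suc sum.atMost_Suc)
  qed
  moreover have "c (Suc u) = 1 / fact (Suc u)"
    by (simp add: c_def a)
  ultimately show ?case
    by blast
qed

lemma det_gchoose:
  fixes b :: "nat \<Rightarrow> 'a::field_char_0"
  shows "det (mat m m (\<lambda>(u, l). b l gchoose u)) =
     (\<Prod>u<m. 1 / fact u) * (\<Prod>v<m. \<Prod>w<v. b v - b w)"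
proof -
  obtain a where a: "\<And>u. a u u = 1 / fact u"
      "\<And>u x. x gchoose u = (\<Sum>v\<le>u. a u v * newton b v x)"
    using gchoose_newton_expansion[of _ b] by metis
  have "det (mat m m (\<lambda>(u, l). b l gchoose u)) =
      (\<Prod>u<m. a u u) * det (mat m m (\<lambda>(v, l). newton b v (b l)))"
    by (rule det_lower_triangular_combination) (rule a)
  \<comment> \<open>For \<open>l < v\<close> the product contains the factor
    \<open>b l - b l\<close>, so only the diagonal contributes.\<close>
  moreover have "det (mat m m (\<lambda>(v, l). newton b v (b l))) = (\<Prod>v<m. \<Prod>w<v. b v - b w)"
    by (subst det_upper_triangular[of _ m])
       (auto simp: prod_list_diag_prod lessThan_atLeast0 newton_def upper_triangular_def
         intro!: prod_zero)
  ultimately show ?thesis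
    by (simp add: a)
qed

section \<open>Integrality of binomials and of rational eigenvalues\<close>

text \<open>Negative \<open>z\<close> does occur: two words of \<open>C\<close> may differ in all
  \<open>n\<close> places while \<open>N = n - 1\<close>. Negating the upper index then reduces to
  an ordinary binomial coefficient.\<close>

lemma gchoose_in_Ints: "(of_int z gchoose k :: 'a::field_char_0) \<in> \<int>"
proof (cases "z \<ge> 0")
  case True
  then show ?thesis
    by (metis Ints_of_nat binomial_gbinomial of_int_of_nat_eq zero_le_imp_eq_int)
next
  case False
  then obtain m where m: "z = - int m" "m > 0"
    by (metis neg_int_cases not_le)
  have "(of_int z gchoose k :: 'a) = (-1) ^ k * ((of_nat k - of_int z - 1) gchoose k)"
    by (rule gbinomial_negated_upper)
  also have "(of_nat k - of_int z - 1 :: 'a) = of_nat (k + m - 1)"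
    using m by (simp add: of_nat_diff)
  finally show ?thesis
    by (simp flip: binomial_gbinomial)
qed

text \<open>Once \<open>v\<close> is scaled to an integral vector, applying the integer matrix
  \<open>k\<close> times shows that \<open>p ^ k\<close> times it is still integral. So every power
  of the denominator of \<open>p\<close> divides one fixed nonzero integer, which forces that
  denominator to be 1.\<close>

lemma rational_eigenvalue_in_Ints:
  fixes v :: "'a \<Rightarrow> rat" and p :: rat
  assumes "finite X" "x0 \<in> X" "v x0 \<noteq> 0"
    and A: "\<And>x y. x \<in> X \<Longrightarrow> y \<in> X \<Longrightarrow> A x y \<in> \<int>"
    and eigen: "\<And>x. x \<in> X \<Longrightarrow> (\<Sum>y\<in>X. A x y * v y) = p * v x"
  shows "p \<in> \<int>"
proof -
  obtain d :: int where d: "d > 0" "\<And>x. x \<in> X \<Longrightarrow> of_int d * v x \<in> \<int>"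
  proof -
    define den where "den x = snd (quotient_of (v x))" for x
    define d where "d = (\<Prod>x\<in>X. den x)"
    have "den x > 0" for x
      by (simp add: den_def quotient_of_denom_pos')
    then have "d > 0"
      by (simp add: d_def prod_pos)
    moreover have "of_int d * v x \<in> \<int>" if "x \<in> X" for x
    proof -
      have "d = den x * (\<Prod>y\<in>X - {x}. den y)"
        unfolding d_def using assms(1) that by (rule prod.remove)
      moreover have "of_int (den x) * v x = of_int (fst (quotient_of (v x)))"
        using quotient_of_div[of "v x" "fst (quotient_of (v x))" "den x"] \<open>den x > 0\<close>
        unfolding den_def by (metis less_numeral_extra(3) nonzero_mult_div_cancel_left of_int_eq_0_iff
            prod.collapse times_divide_eq_right)
      ultimately have "of_int d * v x = of_int ((\<Prod>y\<in>X - {x}. den y) * fst (quotient_of (v x)))"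
        by (metis mult.assoc mult.commute of_int_mult)
      then show ?thesis
        by (simp only: Ints_of_int)
    qed
    ultimately show ?thesis
      using that by blast
  qed
  have pow: "\<forall>x\<in>X. p ^ k * (of_int d * v x) \<in> \<int>" for k
  proof (induction k)
    case (Suc k)
    have "p ^ Suc k * (of_int d * v x) = (\<Sum>y\<in>X. A x y * (p ^ k * (of_int d * v y)))" if "x \<in> X" for x
    proof -
      have "(\<Sum>y\<in>X. A x y * (p ^ k * (of_int d * v y))) = p ^ k * of_int d * (\<Sum>y\<in>X. A x y * v y)"
        by (simp add: sum_distrib_left ac_simps)
      then show ?thesis
        using eigen[OF that] by simp
    qed
    moreover have "A x y * (p ^ k * (of_int d * v y)) \<in> \<int>" if "x \<in> X" "y \<in> X" for x y
      using that Suc A Ints_mult by blast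
    ultimately show ?case
      by (metis (no_types, lifting) Ints_sum)
  qed (use d in simp)
  obtain a b where ab: "quotient_of p = (a, b)"
    by fastforce
  then have b: "b > 0" "coprime a b" "p = of_int a / of_int b"
    using quotient_of_denom_pos quotient_of_coprime quotient_of_div by auto
  obtain c where c: "of_int d * v x0 = of_int c"
    using d(2)[OF assms(2)] by (elim Ints_cases)
  have "c \<noteq> 0"
    using c d(1) assms(3) by auto
  have "b ^ k dvd c" for k
  proof -
    obtain e where "p ^ k * of_int c = of_int e"
      using pow[of k] assms(2) c by (metis Ints_cases)
    then have "of_int (a ^ k * c) = (of_int (e * b ^ k) :: rat)"
      using b by (simp add: power_divide field_simps)
    then have "a ^ k * c = e * b ^ k"
      by (simp only: of_int_eq_iff)
    then have "b ^ k dvd a ^ k * c"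
      by simp
    moreover have "coprime (b ^ k) (a ^ k)"
      using b by (simp add: coprime_commute)
    ultimately show ?thesis
      by (simp add: coprime_dvd_mult_right_iff)
  qed
  have "b = 1"
  \<comment> \<open>A denominator \<open>b\<close> of at least 2 would give
    \<open>b ^ k > k\<close>; at \<open>k = \<bar>c\<bar>\<close> this power is too large to divide
    \<open>c\<close>.\<close>
  proof (rule ccontr)
    assume "b \<noteq> 1"
    then have "b \<ge> 2"
      using b by simp
    have "int k < b ^ k" for k
    proof (induction k)
      case (Suc k)
      have "int (Suc k) \<le> b ^ k" "b ^ k > 0"
        using Suc b by auto
      then have "int (Suc k) < 2 * b ^ k"
        by linarith
      also have "\<dots> \<le> b ^ Suc k"
        using \<open>b \<ge> 2\<close> \<open>b ^ k > 0\<close> by simp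
      finally show ?case .
    qed simp
    from this[of "nat \<bar>c\<bar>"] have "\<bar>c\<bar> < b ^ nat \<bar>c\<bar>"
      by simp
    then show False
      using \<open>c \<noteq> 0\<close> dvd_imp_le_int[OF \<open>c \<noteq> 0\<close> \<open>b ^ nat \<bar>c\<bar> dvd c\<close>] by linarith
  qed
  then show ?thesis
    using b by simp
qed

section \<open>Inclusion-exclusion and Krawtchouk polynomials\<close>

text \<open>Pair each \<open>V\<close> without \<open>t\<close> with \<open>insert t V\<close>: the
  values of \<open>g\<close> agree and the signs are opposite.\<close>

lemma sum_Pow_toggle_cancel:
  fixes g :: "'a set \<Rightarrow> 'b::comm_ring_1"
  assumes "finite T" "t \<in> T" "\<And>V. V \<subseteq> T - {t} \<Longrightarrow> g (insert t V) = g V"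
  shows "(\<Sum>V\<in>Pow T. (-1) ^ card (T - V) * g V) = 0"
proof -
  define S where "S = T - {t}"
  have T: "T = insert t S" and tS: "t \<notin> S" and fS: "finite S"
    using assms by (auto simp: S_def)
  have inj: "inj_on (insert t) (Pow S)"
    using tS by (auto simp: inj_on_def)
  have "(\<Sum>V\<in>Pow T. (-1) ^ card (T - V) * g V) =
        (\<Sum>V\<in>Pow S. (-1) ^ card (T - V) * g V) +
        (\<Sum>V\<in>insert t ` Pow S. (-1) ^ card (T - V) * g V)"
    unfolding T Pow_insert
    using tS fS by (intro sum.union_disjoint) auto
  also have "(\<Sum>V\<in>insert t ` Pow S. (-1) ^ card (T - V) * g V) =
      (\<Sum>V\<in>Pow S. (-1) ^ card (S - V) * g V)"
  proof -
    have "T - insert t V = S - V" for V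
      using tS by (auto simp: T)
    moreover have "g (insert t V) = g V" if "V \<in> Pow S" for V
      using that assms(3) by (simp add: S_def)
    ultimately show ?thesis
      by (auto simp: sum.reindex[OF inj] intro!: sum.cong)
  qed
  also have "(\<Sum>V\<in>Pow S. (-1) ^ card (T - V) * g V) = (\<Sum>V\<in>Pow S. - ((-1) ^ card (S - V) * g V))"
  proof (rule sum.cong)
    fix V assume V: "V \<in> Pow S"
    have "T - V = insert t (S - V)"
      using V tS by (auto simp: T)
    then have "card (T - V) = Suc (card (S - V))"
      using tS fS by simp
    then show "(-1) ^ card (T - V) * g V = - ((-1) ^ card (S - V) * g V)"
      by simp
  qed simp
  finally show ?thesis
    by (simp add: sum_negf)
qed

lemma card_supersets:
  assumes "finite I" "U \<subseteq> I" "card U \<le> k"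
  shows "card {T. U \<subseteq> T \<and> T \<subseteq> I \<and> card T = k} = (card I - card U) choose (k - card U)"
proof -
  have fU: "finite U"
    using assms finite_subset by blast
  have "bij_betw (\<lambda>T. T - U) {T. U \<subseteq> T \<and> T \<subseteq> I \<and> card T = k}
          {W. W \<subseteq> I - U \<and> card W = k - card U}"
  proof (rule bij_betw_byWitness[where f' = "\<lambda>W. W \<union> U"])
    show "(\<lambda>T. T - U) ` {T. U \<subseteq> T \<and> T \<subseteq> I \<and> card T = k} \<subseteq> {W. W \<subseteq> I - U \<and> card W = k - card U}"
      using fU by (auto simp: card_Diff_subset)
    show "(\<lambda>W. W \<union> U) ` {W. W \<subseteq> I - U \<and> card W = k - card U} \<subseteq> {T. U \<subseteq> T \<and> T \<subseteq> I \<and> card T = k}"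
    proof clarsimp
      fix W assume W: "W \<subseteq> I - U" "card W = k - card U"
      then have "card (W \<union> U) = card W + card U"
        using fU assms finite_subset[of W I] by (intro card_Un_disjoint) auto
      then show "W \<subseteq> I \<and> U \<subseteq> I \<and> card (W \<union> U) = k"
        using W assms by auto
    qed
  qed auto
  then have "card {T. U \<subseteq> T \<and> T \<subseteq> I \<and> card T = k} = card {W. W \<subseteq> I - U \<and> card W = k - card U}"
    by (rule bij_betw_same_card)
  also have "\<dots> = card (I - U) choose (k - card U)"
    using assms by (intro n_subsets) auto
  finally show ?thesis
    using assms fU by (simp add: card_Diff_subset)
qed

text \<open>The generalized binomial coefficient keeps this a polynomial of degree \<open>k\<close> in \<open>d\<close>, also
  beyond \<open>d = N\<close>.\<close>

definition krawtchouk :: "nat \<Rightarrow> nat \<Rightarrow> nat \<Rightarrow> nat \<Rightarrow> rat" where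
  "krawtchouk N q k d =
     (\<Sum>u\<le>k. (-1) ^ (k - u) * of_nat q ^ u * of_nat ((N - u) choose (k - u)) *
        ((of_nat N - of_nat d) gchoose u))"

text \<open>After \<open>choose_mult\<close> pulls out \<open>N choose k\<close>, the binomial
  theorem for \<open>(q - 1) ^ k\<close> remains. These values give the diagonal entries of the
  idempotents.\<close>

lemma krawtchouk_0:
  assumes "q \<ge> 1" "k \<le> N"
  shows "krawtchouk N q k 0 = of_nat ((N choose k) * (q - 1) ^ k)"
proof -
  have "krawtchouk N q k 0 =
      (\<Sum>u\<le>k. of_nat (N choose k) * (of_nat (k choose u) * of_nat q ^ u * (-1) ^ (k - u)))"
    unfolding krawtchouk_def
  proof (rule sum.cong)
    fix u assume "u \<in> {..k}"
    then have "(N choose k) * (k choose u) = (N choose u) * ((N - u) choose (k - u))"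
      using assms by (intro choose_mult) auto
    then have "rat_of_nat (N choose k) * of_nat (k choose u)
        = of_nat (N choose u) * of_nat ((N - u) choose (k - u))"
      by (metis of_nat_mult)
    moreover have "((rat_of_nat N - of_nat 0) gchoose u) = of_nat (N choose u)"
      by (simp add: binomial_gbinomial)
    ultimately show "(-1) ^ (k - u) * of_nat q ^ u * of_nat ((N - u) choose (k - u)) *
        ((rat_of_nat N - of_nat 0) gchoose u) =
        of_nat (N choose k) * (of_nat (k choose u) * of_nat q ^ u * (-1) ^ (k - u))"
      by (simp add: algebra_simps)
  qed simp
  also have "\<dots> = of_nat (N choose k) * (of_nat q + (-1)) ^ k"
    by (simp only: sum_distrib_left binomial_ring)
  also have "rat_of_nat q + (-1) = of_nat (q - 1)"
    using assms by simp
  finally show ?thesis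
    by simp
qed

section \<open>The idempotents of a code of strength \<open>2 * s - 2\<close>\<close>

text \<open>Words may carry coordinates outside \<open>I\<close>, so a fixed first letter need not
  be deleted; \<open>ext\<close> says that \<open>I\<close> determines the word. The bound
  \<open>s_le\<close> keeps \<open>card I choose k\<close> nonzero for \<open>k < s\<close>.\<close>

locale hamming_code =
  fixes I :: "'a set" and X :: "('a \<Rightarrow> 'b) set" and Q :: "'b set" and q s :: nat
  assumes finite_I: "finite I" and finite_X: "finite X" and X_nonempty: "X \<noteq> {}"
    and q_ge_2: "q \<ge> 2" and s_le: "s \<le> Suc (card I)"
    and letters: "\<And>x i. x \<in> X \<Longrightarrow> i \<in> I \<Longrightarrow> x i \<in> Q"
    and ext: "\<And>x y. x \<in> X \<Longrightarrow> y \<in> X \<Longrightarrow> (\<And>i. i \<in> I \<Longrightarrow> x i = y i) \<Longrightarrow> x = y"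
    and strength: "\<And>T w. T \<subseteq> I \<Longrightarrow> card T \<le> 2 * s - 2 \<Longrightarrow> (\<And>i. i \<in> T \<Longrightarrow> w i \<in> Q) \<Longrightarrow>
      q ^ card T * card {x \<in> X. \<forall>i\<in>T. x i = w i} = card X"
begin

definition M :: rat where "M = of_nat (card X)"

definition hdist :: "('a \<Rightarrow> 'b) \<Rightarrow> ('a \<Rightarrow> 'b) \<Rightarrow> nat" where
  "hdist x y = card {i \<in> I. x i \<noteq> y i}"

text \<open>For \<open>card T \<le> 2 * s - 2\<close> each agreement class on \<open>T\<close> has
  \<open>M / q ^ card T\<close> words, so this matrix averages a function over the words that agree
  on \<open>T\<close>.\<close>

definition agree :: "'a set \<Rightarrow> ('a \<Rightarrow> 'b) \<Rightarrow> ('a \<Rightarrow> 'b) \<Rightarrow> rat" where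
  "agree T x y = (if \<forall>i\<in>T. x i = y i then of_nat q ^ card T / M else 0)"

text \<open>Moebius inversion of \<open>agree\<close> over subsets: the part of averaging on
  \<open>T\<close> not already accounted for by proper subsets.\<close>

definition F :: "'a set \<Rightarrow> ('a \<Rightarrow> 'b) \<Rightarrow> ('a \<Rightarrow> 'b) \<Rightarrow> rat" where
  "F T x y = (\<Sum>U\<in>Pow T. (-1) ^ card (T - U) * agree U x y)"

definition E :: "nat \<Rightarrow> ('a \<Rightarrow> 'b) \<Rightarrow> ('a \<Rightarrow> 'b) \<Rightarrow> rat" where
  "E k x y = (\<Sum>T | T \<subseteq> I \<and> card T = k. F T x y)"

abbreviation K :: "nat \<Rightarrow> nat \<Rightarrow> rat" where
  "K \<equiv> krawtchouk (card I) q"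

lemma M_pos: "M > 0"
  using finite_X X_nonempty by (simp add: M_def card_gt_0_iff)

lemma hdist_eq_0_iff:
  assumes "x \<in> X" "y \<in> X"
  shows "hdist x y = 0 \<longleftrightarrow> x = y"
  using ext[OF assms] finite_I by (auto simp: hdist_def)

text \<open>The product counts words with prescribed letters on \<open>T \<union> S\<close>, a set
  of at most \<open>2 * s - 2\<close> coordinates; this is where the strength enters. The
  prescriptions are compatible exactly if \<open>x\<close> and \<open>y\<close> agree on
  \<open>T \<inter> S\<close>.\<close>

lemma agree_mult:
  assumes T: "T \<subseteq> I" "card T < s" and S: "S \<subseteq> I" "card S < s" and xy: "x \<in> X" "y \<in> X"
  shows "(\<Sum>z\<in>X. agree T x z * agree S z y) = agree (T \<inter> S) x y"
proof -
  have fin: "finite T" "finite S"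
    using T S finite_I finite_subset by auto
  have cards: "card (T \<union> S) + card (T \<inter> S) = card T + card S"
    using card_Un_Int[OF fin] by simp
  let ?Z = "{z \<in> X. (\<forall>i\<in>T. x i = z i) \<and> (\<forall>i\<in>S. z i = y i)}"
  have "(\<Sum>z\<in>X. agree T x z * agree S z y) =
      (\<Sum>z\<in>X. if (\<forall>i\<in>T. x i = z i) \<and> (\<forall>i\<in>S. z i = y i)
         then of_nat q ^ (card T + card S) / M\<^sup>2 else 0)"
    by (rule sum.cong) (auto simp: agree_def power_add power2_eq_square)
  also have "\<dots> = (\<Sum>z\<in>?Z. of_nat q ^ (card T + card S) / M\<^sup>2)"
    by (rule sum.inter_filter[symmetric]) (rule finite_X)
  finally have 1: "(\<Sum>z\<in>X. agree T x z * agree S z y) =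
      of_nat (card ?Z) * (of_nat q ^ (card T + card S) / M\<^sup>2)"
    by simp
  show ?thesis
  proof (cases "\<forall>i\<in>T \<inter> S. x i = y i")
    case True
    define w where "w i = (if i \<in> T then x i else y i)" for i
    have "?Z = {z \<in> X. \<forall>i\<in>T \<union> S. z i = w i}"
      using True by (auto simp: w_def)
    moreover have "q ^ card (T \<union> S) * card {z \<in> X. \<forall>i\<in>T \<union> S. z i = w i} = card X"
      using T S xy cards letters by (intro strength) (auto simp: w_def)
    ultimately have "q ^ card (T \<union> S) * card ?Z = card X"
      by simp
    then have "of_nat (q ^ card (T \<union> S) * card ?Z) = M"
      unfolding M_def by (rule arg_cong)
    then have "of_nat q ^ card (T \<union> S) * of_nat (card ?Z) = M"
      by simp
    then have "of_nat (card ?Z) * of_nat q ^ (card T + card S) = M * of_nat q ^ card (T \<inter> S)"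
      unfolding cards[symmetric] power_add by (simp add: ac_simps)
    then have "of_nat (card ?Z) * (of_nat q ^ (card T + card S) / M\<^sup>2) = of_nat q ^ card (T \<inter> S) / M"
      using M_pos by (simp add: power2_eq_square)
    then show ?thesis
      using True 1 by (simp add: agree_def[of "T \<inter> S"])
  next
    case False
    then have "?Z = {}"
      by (metis (mono_tags, lifting) IntE empty_Collect_eq)
    then have "(\<Sum>z\<in>X. agree T x z * agree S z y) = 0"
      unfolding 1 by (simp only: card.empty of_nat_0 mult_zero_left)
    then show ?thesis
      using False by (simp only: agree_def[of "T \<inter> S"] if_False)
  qed
qed

text \<open>If some \<open>t\<close> in \<open>T\<close> lies outside \<open>U\<close>, adding
  \<open>t\<close> to \<open>V\<close> leaves \<open>U \<inter> V\<close> unchanged and the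
  alternating sum cancels.\<close>

lemma agree_F:
  assumes U: "U \<subseteq> I" "card U < s" and T: "T \<subseteq> I" "card T < s" and xy: "x \<in> X" "y \<in> X"
  shows "(\<Sum>z\<in>X. agree U x z * F T z y) = (if T \<subseteq> U then F T x y else 0)"
proof -
  have fT: "finite T"
    using T finite_I finite_subset by auto
  have "(\<Sum>z\<in>X. agree U x z * F T z y) =
      (\<Sum>z\<in>X. \<Sum>V\<in>Pow T. (-1) ^ card (T - V) * (agree U x z * agree V z y))"
    by (simp add: F_def sum_distrib_left mult.left_commute)
  also have "\<dots> = (\<Sum>V\<in>Pow T. (-1) ^ card (T - V) * (\<Sum>z\<in>X. agree U x z * agree V z y))"
    by (subst sum.swap) (simp add: sum_distrib_left)
  also have "\<dots> = (\<Sum>V\<in>Pow T. (-1) ^ card (T - V) * agree (U \<inter> V) x y)"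
  proof (rule sum.cong)
    fix V assume V: "V \<in> Pow T"
    then have "card V \<le> card T"
      using fT by (auto intro: card_mono)
    then have "(\<Sum>z\<in>X. agree U x z * agree V z y) = agree (U \<inter> V) x y"
      using V T U xy by (intro agree_mult) auto
    then show "(-1) ^ card (T - V) * (\<Sum>z\<in>X. agree U x z * agree V z y) =
        (-1) ^ card (T - V) * agree (U \<inter> V) x y"
      by simp
  qed simp
  also have "\<dots> = (if T \<subseteq> U then F T x y else 0)"
  proof (cases "T \<subseteq> U")
    case True
    then have "U \<inter> V = V" if "V \<in> Pow T" for V
      using that by auto
    then show ?thesis
      using True by (auto simp: F_def intro!: sum.cong)
  next
    case False
    then obtain t where t: "t \<in> T" "t \<notin> U"
      by auto
    then have "(\<Sum>V\<in>Pow T. (-1) ^ card (T - V) * agree (U \<inter> V) x y) = 0"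
      by (intro sum_Pow_toggle_cancel[OF fT t(1)]) simp
    then show ?thesis
      using False by simp
  qed
  finally show ?thesis .
qed

lemma F_mult:
  assumes S: "S \<subseteq> I" "card S < s" and T: "T \<subseteq> I" "card T < s" and xy: "x \<in> X" "y \<in> X"
  shows "(\<Sum>z\<in>X. F S x z * F T z y) = (if S = T then F T x y else 0)"
proof -
  have fS: "finite S"
    using S finite_I finite_subset by auto
  have "(\<Sum>z\<in>X. F S x z * F T z y) =
      (\<Sum>z\<in>X. \<Sum>U\<in>Pow S. (-1) ^ card (S - U) * (agree U x z * F T z y))"
    by (simp add: F_def[of S] sum_distrib_right mult.assoc)
  also have "\<dots> = (\<Sum>U\<in>Pow S. (-1) ^ card (S - U) * (\<Sum>z\<in>X. agree U x z * F T z y))"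
    by (subst sum.swap) (simp add: sum_distrib_left)
  also have "\<dots> = (\<Sum>U\<in>Pow S. (-1) ^ card (S - U) * (if T \<subseteq> U then F T x y else 0))"
  proof (rule sum.cong)
    fix U assume U: "U \<in> Pow S"
    then have "card U \<le> card S"
      using fS by (auto intro: card_mono)
    then show "(-1) ^ card (S - U) * (\<Sum>z\<in>X. agree U x z * F T z y) =
        (-1) ^ card (S - U) * (if T \<subseteq> U then F T x y else 0)"
      using U S T xy by (subst agree_F) auto
  qed simp
  also have "\<dots> = (if S = T then F T x y else 0)"
  proof (cases "S \<subseteq> T")
    \<comment> \<open>A nonzero term needs
      \<open>T \<subseteq> U \<subseteq> S \<subseteq> T\<close>, hence
      \<open>U = S = T\<close>.\<close>
    case True
    have "(\<Sum>U\<in>Pow S. (-1) ^ card (S - U) * (if T \<subseteq> U then F T x y else 0)) =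
        (\<Sum>U\<in>Pow S. if U = S then (if S = T then F T x y else 0) else 0)"
      using True by (intro sum.cong) auto
    then show ?thesis
      using fS by (simp add: sum.delta)
  next
    case False
    then obtain t where t: "t \<in> S" "t \<notin> T"
      by auto
    then have "(\<Sum>U\<in>Pow S. (-1) ^ card (S - U) * (if T \<subseteq> U then F T x y else 0)) = 0"
      by (intro sum_Pow_toggle_cancel[OF fS t(1)]) (auto simp: subset_insert)
    then show ?thesis
      using False by auto
  qed
  finally show ?thesis .
qed

lemma E_mult:
  assumes "j < s" "k < s" "x \<in> X" "y \<in> X"
  shows "(\<Sum>z\<in>X. E k x z * E j z y) = (if k = j then E j x y else 0)"
proof -
  let ?P = "\<lambda>k. {T. T \<subseteq> I \<and> card T = k}"
  have fP: "finite (?P k)" for k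
    using finite_I by simp
  have "(\<Sum>z\<in>X. E k x z * E j z y) = (\<Sum>z\<in>X. \<Sum>S\<in>?P k. \<Sum>T\<in>?P j. F S x z * F T z y)"
    by (simp add: E_def sum_product)
  also have "\<dots> = (\<Sum>S\<in>?P k. \<Sum>T\<in>?P j. \<Sum>z\<in>X. F S x z * F T z y)"
    by (subst sum.swap) (subst sum.swap[of _ X], rule refl)
  also have "\<dots> = (\<Sum>S\<in>?P k. \<Sum>T\<in>?P j. if S = T then F T x y else 0)"
    using assms by (intro sum.cong refl F_mult) auto
  also have "\<dots> = (\<Sum>S\<in>?P k. if S \<in> ?P j then F S x y else 0)"
    using fP by (simp only: sum.delta')
  also have "\<dots> = (if k = j then E j x y else 0)"
    by (auto simp: E_def intro!: sum.neutral)
  finally show ?thesis .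
qed

text \<open>Exchange the sums over \<open>T\<close> and \<open>U\<close>: a set \<open>U\<close> of
  size \<open>u\<close> lies in \<open>(card I - u) choose (k - u)\<close> sets of size
  \<open>k\<close>. It contributes only if it lies inside the set where \<open>x\<close> and
  \<open>y\<close> agree, which has \<open>card I - hdist x y\<close> elements.\<close>

lemma E_eq_krawtchouk:
  assumes "x \<in> X" "y \<in> X"
  shows "E k x y = K k (hdist x y) / M"
proof -
  let ?P = "{T. T \<subseteq> I \<and> card T = k}"
  let ?G = "{i \<in> I. x i = y i}"
  let ?f = "\<lambda>U. (-1) ^ (k - card U) * agree U x y"
  let ?N = "card I"
  have fin: "finite T" if "T \<subseteq> I" for T
    using that finite_I finite_subset by blast
  have cardG: "card ?G + hdist x y = ?N"
  proof -
    have "card (?G \<union> {i \<in> I. x i \<noteq> y i}) = card ?G + hdist x y"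
      unfolding hdist_def using finite_I by (intro card_Un_disjoint) auto
    moreover have "?G \<union> {i \<in> I. x i \<noteq> y i} = I"
      by auto
    ultimately show ?thesis
      by simp
  qed
  have "E k x y = (\<Sum>T\<in>?P. \<Sum>U\<in>{U\<in>{U. U \<subseteq> I \<and> card U \<le> k}. U \<subseteq> T}. ?f U)"
    unfolding E_def F_def
  proof (intro sum.cong refl)
    fix T assume "T \<in> ?P"
    then have T: "T \<subseteq> I" "card T = k"
      by auto
    show "Pow T = {U\<in>{U. U \<subseteq> I \<and> card U \<le> k}. U \<subseteq> T}"
      using T fin[of T] by (auto intro: card_mono)
    fix U assume "U \<in> {U\<in>{U. U \<subseteq> I \<and> card U \<le> k}. U \<subseteq> T}"
    then have "card (T - U) = k - card U"
      using T fin by (auto simp: card_Diff_subset)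
    then show "(-1) ^ card (T - U) * agree U x y = ?f U"
      by simp
  qed
  also have "\<dots> = (\<Sum>U\<in>{U. U \<subseteq> I \<and> card U \<le> k}. \<Sum>T\<in>{T\<in>?P. U \<subseteq> T}. ?f U)"
    using finite_I by (intro sum.swap_restrict) auto
  also have "\<dots> = (\<Sum>U\<in>{U. U \<subseteq> I \<and> card U \<le> k}. of_nat ((?N - card U) choose (k - card U)) * ?f U)"
  proof (rule sum.cong)
    fix U assume "U \<in> {U. U \<subseteq> I \<and> card U \<le> k}"
    moreover have "{T\<in>?P. U \<subseteq> T} = {T. U \<subseteq> T \<and> T \<subseteq> I \<and> card T = k}"
      by auto
    ultimately show "(\<Sum>T\<in>{T\<in>?P. U \<subseteq> T}. ?f U) = of_nat ((?N - card U) choose (k - card U)) * ?f U"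
      using card_supersets[OF finite_I, of U k] by simp
  qed simp
  also have "\<dots> = (\<Sum>u\<le>k. \<Sum>U\<in>{U\<in>{U. U \<subseteq> I \<and> card U \<le> k}. card U = u}.
      of_nat ((?N - card U) choose (k - card U)) * ?f U)"
    using finite_I by (intro sum.group[symmetric]) auto
  also have "\<dots> = (\<Sum>u\<le>k. (-1) ^ (k - u) * of_nat q ^ u * of_nat ((?N - u) choose (k - u)) *
        ((of_nat ?N - of_nat (hdist x y)) gchoose u) / M)"
  proof (rule sum.cong)
    fix u assume u: "u \<in> {..k}"
    have "(\<Sum>U\<in>{U\<in>{U. U \<subseteq> I \<and> card U \<le> k}. card U = u}.
      of_nat ((?N - card U) choose (k - card U)) * ?f U) =
      (\<Sum>U\<in>{U. U \<subseteq> I \<and> card U = u}. if U \<subseteq> ?G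
         then (-1) ^ (k - u) * of_nat q ^ u * of_nat ((?N - u) choose (k - u)) / M else 0)"
      using u by (intro sum.cong) (auto simp: agree_def)
    also have "\<dots> = (\<Sum>U\<in>{U\<in>{U. U \<subseteq> I \<and> card U = u}. U \<subseteq> ?G}.
        (-1) ^ (k - u) * of_nat q ^ u * of_nat ((?N - u) choose (k - u)) / M)"
      using finite_I by (intro sum.inter_filter[symmetric]) auto
    also have "{U\<in>{U. U \<subseteq> I \<and> card U = u}. U \<subseteq> ?G} = {U. U \<subseteq> ?G \<and> card U = u}"
      by auto
    also have "(\<Sum>U\<in>{U. U \<subseteq> ?G \<and> card U = u}.
        (-1) ^ (k - u) * of_nat q ^ u * of_nat ((?N - u) choose (k - u)) / M) =
        of_nat (card ?G choose u) *
        ((-1) ^ (k - u) * of_nat q ^ u * of_nat ((?N - u) choose (k - u)) / M)"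
      using finite_I by (simp add: n_subsets)
    also have "rat_of_nat (card ?G choose u) = (of_nat (card ?G) gchoose u)"
      by (simp add: binomial_gbinomial)
    also have "rat_of_nat (card ?G) = of_nat ?N - of_nat (hdist x y)"
      using cardG by (metis add_diff_cancel_right' of_nat_add)
    finally show "(\<Sum>U\<in>{U\<in>{U. U \<subseteq> I \<and> card U \<le> k}. card U = u}.
      of_nat ((?N - card U) choose (k - card U)) * ?f U) =
       (-1) ^ (k - u) * of_nat q ^ u * of_nat ((?N - u) choose (k - u)) *
        ((of_nat ?N - of_nat (hdist x y)) gchoose u) / M"
      by simp
  qed simp
  finally show ?thesis
    by (simp add: krawtchouk_def sum_divide_distrib)
qed

end

section \<open>The Krawtchouk determinant and its divisibility\<close>

lemma det_in_Ints:
  fixes A :: "'a::comm_ring_1 mat"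
  assumes "A \<in> carrier_mat m m" "\<And>i j. i < m \<Longrightarrow> j < m \<Longrightarrow> A $$ (i, j) \<in> \<int>"
  shows "det A \<in> \<int>"
proof -
  have "p i < m" if "p permutes {0..<m}" "i < m" for p i
    using that permutes_in_image by fastforce
  then show ?thesis
    unfolding det_def'[OF assms(1)]
    by (auto intro!: Ints_sum Ints_mult Ints_prod assms(2) simp: sign_def)
qed

lemma krawtchouk_in_Ints: "krawtchouk N q k d \<in> \<int>"
proof -
  have "((rat_of_nat N - of_nat d) gchoose u) \<in> \<int>" for u
    using gchoose_in_Ints[of "int N - int d" u] by simp
  then show ?thesis
    unfolding krawtchouk_def by (intro Ints_sum Ints_mult) auto
qed

text \<open>Each \<open>krawtchouk N q k\<close> is a combination of binomials in
  \<open>N - d\<close> of index at most \<open>k\<close>, with leading coefficient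
  \<open>q ^ k\<close>. Passing from \<open>d\<close> to \<open>N - d\<close> reverses the
  differences of the nodes.\<close>

lemma det_krawtchouk:
  "det (mat m m (\<lambda>(k, l). krawtchouk N q k (b l))) =
     (\<Prod>k<m. of_nat q ^ k) * ((\<Prod>k<m. 1 / fact k) *
     (\<Prod>v<m. \<Prod>w<v. of_nat (b w) - of_nat (b v)))"
proof -
  let ?x = "\<lambda>l. rat_of_nat N - of_nat (b l)"
  have "det (mat m m (\<lambda>(k, l). krawtchouk N q k (b l))) =
      (\<Prod>k<m. (-1) ^ (k - k) * of_nat q ^ k * of_nat ((N - k) choose (k - k))) *
      det (mat m m (\<lambda>(u, l). ?x l gchoose u))"
    by (rule det_lower_triangular_combination) (rule krawtchouk_def)
  then show ?thesis
    by (simp add: det_gchoose)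
qed

context hamming_code
begin

text \<open>The nodes \<open>b\<close> need only include the distances in \<open>X\<close>; a node
  that does not occur gives a zero relation matrix, to which the eigenvalue argument still applies.
  The cofactor of the divisor is the determinant of the integral matrix \<open>M c\<close>.\<close>

lemma krawtchouk_det_dvd:
  fixes b :: "nat \<Rightarrow> nat"
  assumes inj: "inj_on b {..<s}" and b_pos: "\<And>l. l < s \<Longrightarrow> b l \<noteq> 0"
    and dists: "\<And>x y. x \<in> X \<Longrightarrow> y \<in> X \<Longrightarrow> x \<noteq> y \<Longrightarrow> hdist x y \<in> b ` {..<s}"
    and card_X: "card X \<noteq> (\<Sum>k<s. (card I choose k) * (q - 1) ^ k)"
  shows "\<exists>d::int. of_int d = det (mat s s (\<lambda>(k, l). K k (b l))) \<and> d dvd int (card X) ^ s"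
proof -
  define Km where "Km = mat s s (\<lambda>(k, l). K k (b l))"
  have Km: "Km \<in> carrier_mat s s"
    by (simp add: Km_def)
  have "rat_of_nat (b w) - of_nat (b v) \<noteq> 0" if "w < v" "v < s" for v w
    using that inj by (auto simp: inj_on_def)
  then have det_nz: "det Km \<noteq> 0"
    using q_ge_2 by (auto simp: Km_def det_krawtchouk)
  define c where "c = (1 / det Km) \<cdot>\<^sub>m adj_mat Km"
  have c: "c \<in> carrier_mat s s"
    using adj_mat(1)[OF Km] by (simp add: c_def)
  have "c * Km = (1 / det Km) \<cdot>\<^sub>m (det Km \<cdot>\<^sub>m 1\<^sub>m s)"
    unfolding c_def using adj_mat[OF Km] Km by (simp add: mult_smult_assoc_mat[of _ s s _ s])
  then have inverse: "c * Km = 1\<^sub>m s"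
    using det_nz by (auto intro!: eq_matI)
  have c_sum: "(\<Sum>k<s. c $$ (i, k) * K k (b l)) = (if i = l then 1 else 0)" if "i < s" "l < s" for i l
  proof -
    have "(c * Km) $$ (i, l) = (\<Sum>k<s. c $$ (i, k) * K k (b l))"
      using that c by (simp add: Km_def scalar_prod_def lessThan_atLeast0)
    then show ?thesis
      using that inverse by simp
  qed
  \<comment> \<open>Row \<open>i\<close> of \<open>c\<close> gives the interpolation polynomial that
    is 1 at \<open>b i\<close> and 0 at the other nodes. Its value at distance 0, which is not a
    node, is \<open>L i\<close> and must be removed from the diagonal.\<close>
  define L where "L i = (\<Sum>k<s. c $$ (i, k) * K k 0)" for i
  define adj where "adj i x y = (if hdist x y = b i then 1 else 0 :: rat)" for i x y
  have adj: "adj i x y = (\<Sum>k<s. c $$ (i, k) * (M * E k x y)) - (if x = y then L i else 0)"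
    if "i < s" "x \<in> X" "y \<in> X" for i x y
  proof -
    have ME: "M * E k x y = K k (hdist x y)" for k
      using that M_pos by (simp add: E_eq_krawtchouk)
    show ?thesis
    proof (cases "x = y")
      case True
      then have "hdist x y = 0"
        using that by (simp add: hdist_eq_0_iff)
      then show ?thesis
        using True that b_pos[of i] unfolding ME adj_def L_def by simp
    next
      case False
      then obtain l where l: "l < s" "hdist x y = b l"
        using dists[OF \<open>x \<in> X\<close> \<open>y \<in> X\<close>] by blast
      then have "(b l = b i) = (i = l)"
        using inj that by (auto simp: inj_on_def)
      then show ?thesis
        using False l that unfolding ME adj_def by (simp add: c_sum)
    qed
  qed
  have adj_apply: "(\<Sum>y\<in>X. adj i x y * v y) =
      (\<Sum>k<s. c $$ (i, k) * M * (\<Sum>y\<in>X. E k x y * v y)) - L i * v x"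
    if "i < s" "x \<in> X" for i x v
  proof -
    have "(\<Sum>y\<in>X. adj i x y * v y) =
        (\<Sum>y\<in>X. (\<Sum>k<s. c $$ (i, k) * M * (E k x y * v y)) - (if x = y then L i * v y else 0))"
      using that by (intro sum.cong) (auto simp: adj sum_distrib_left algebra_simps)
    also have "\<dots> = (\<Sum>y\<in>X. \<Sum>k<s. c $$ (i, k) * M * (E k x y * v y)) - L i * v x"
      using that finite_X by (simp add: sum_subtractf)
    also have "(\<Sum>y\<in>X. \<Sum>k<s. c $$ (i, k) * M * (E k x y * v y)) =
        (\<Sum>k<s. c $$ (i, k) * M * (\<Sum>y\<in>X. E k x y * v y))"
      by (subst sum.swap) (simp add: sum_distrib_left)
    finally show ?thesis .
  qed
  obtain x0 where x0: "x0 \<in> X"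
    using X_nonempty by auto
  have E_diag: "E j x0 x0 = of_nat ((card I choose j) * (q - 1) ^ j) / M" if "j < s" for j
    using that x0 q_ge_2 s_le E_eq_krawtchouk[OF x0 x0] krawtchouk_0[of q j "card I"]
    hdist_eq_0_iff[OF x0 x0] by simp
  \<comment> \<open>Column \<open>x0\<close> of \<open>1 - \<Sum>E\<close>, a vector killed by every
    \<open>E k\<close> with \<open>k < s\<close>. Its entry at \<open>x0\<close> vanishes only if
    \<open>card X\<close> is the excluded value.\<close>
  define r where "r x = (if x = x0 then 1 else 0) - (\<Sum>j<s. E j x x0)" for x
  have r_nz: "r x0 \<noteq> 0"
  proof
    assume "r x0 = 0"
    then have "(\<Sum>j<s. of_nat ((card I choose j) * (q - 1) ^ j) / M) = 1"
      by (simp add: r_def E_diag)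
    then have "rat_of_nat (\<Sum>j<s. (card I choose j) * (q - 1) ^ j) = M"
      using M_pos by (simp flip: sum_divide_distrib)
    then show False
      using card_X unfolding M_def by (simp only: of_nat_eq_iff)
  qed
  have E_r: "(\<Sum>y\<in>X. E k x y * r y) = 0" if "k < s" "x \<in> X" for k x
  proof -
    have "(\<Sum>y\<in>X. E k x y * r y) =
        (\<Sum>y\<in>X. (if y = x0 then E k x y else 0) - (\<Sum>j<s. E k x y * E j y x0))"
      by (intro sum.cong) (auto simp: r_def algebra_simps sum_distrib_left)
    also have "\<dots> = E k x x0 - (\<Sum>y\<in>X. \<Sum>j<s. E k x y * E j y x0)"
      using x0 finite_X by (simp add: sum_subtractf)
    also have "(\<Sum>y\<in>X. \<Sum>j<s. E k x y * E j y x0) = (\<Sum>j<s. if k = j then E j x x0 else 0)"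
      using that x0 by (subst sum.swap) (simp add: E_mult)
    finally show ?thesis
      using that by simp
  qed
  have Mc: "M * c $$ (i, j) \<in> \<int>" if ij: "i < s" "j < s" for i j
  proof -
    \<comment> \<open>On \<open>r\<close> only the scalar part of the relation matrix acts. Column
      \<open>x0\<close> of \<open>E j\<close> below is fixed by \<open>E j\<close> and killed by the
      other idempotents; the difference of the two eigenvalues is
      \<open>M * c $$ (i, j)\<close>.\<close>
    have "- L i \<in> \<int>"
    proof (rule rational_eigenvalue_in_Ints[where v = r and A = "adj i", OF finite_X x0 r_nz])
      show "(\<Sum>y\<in>X. adj i x y * r y) = - L i * r x" if "x \<in> X" for x
        using that ij by (simp add: adj_apply E_r)
    qed (simp add: adj_def)
    moreover have "M * c $$ (i, j) - L i \<in> \<int>"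
    proof (rule rational_eigenvalue_in_Ints[where v = "\<lambda>x. E j x x0" and A = "adj i", OF finite_X x0])
      show "E j x0 x0 \<noteq> 0"
        using ij q_ge_2 s_le M_pos by (simp add: E_diag)
      show "(\<Sum>y\<in>X. adj i x y * E j y x0) = (M * c $$ (i, j) - L i) * E j x x0" if "x \<in> X" for x
        using that ij x0 by (simp add: adj_apply E_mult algebra_simps if_distrib cong: if_cong)
    qed (simp add: adj_def)
    ultimately show ?thesis
      using Ints_diff by fastforce
  qed
  have "det (M \<cdot>\<^sub>m c) \<in> \<int>"
    using c Mc by (intro det_in_Ints[of _ s]) auto
  then obtain e where e: "det (M \<cdot>\<^sub>m c) = of_int e"
    by (elim Ints_cases)
  have "det Km \<in> \<int>"
    by (intro det_in_Ints[of _ s]) (auto simp: Km_def krawtchouk_in_Ints)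
  then obtain d where d: "det Km = of_int d"
    by (elim Ints_cases)
  have "det c * det Km = 1"
    using det_mult[OF c Km] inverse by simp
  then have "of_int e * of_int d = M ^ s"
    using c unfolding e[symmetric] d[symmetric] by simp
  then have "of_int (e * d) = (of_int (int (card X) ^ s) :: rat)"
    by (simp add: M_def)
  then have "e * d = int (card X) ^ s"
    by (simp only: of_int_eq_iff)
  then show ?thesis
    using d unfolding Km_def by (metis dvd_triv_right)
qed

end

section \<open>Lower strengths of a design and the tight bound\<close>

text \<open>Constancy of the counts descends from size \<open>t\<close> to smaller sets, because a
  count on \<open>T\<close> is the sum over the \<open>q\<close> letters at one further coordinate.
  A second induction, upward from the empty set, determines the constants.\<close>

lemma hamming_design_count:
  assumes des: "hamming_design n q t C"
    and T: "T \<subseteq> {1..n}" "card T \<le> t" and w: "\<And>i. i \<in> T \<Longrightarrow> w i \<in> {1..q}"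
  shows "q ^ card T * card {x \<in> C. \<forall>i\<in>T. x i = w i} = card C"
proof -
  define cnt where "cnt T w = card {x \<in> C. \<forall>i\<in>T. x i = w i}" for T and w :: "nat \<Rightarrow> nat"
  have CW: "C \<subseteq> words n q" and tn: "t \<le> n"
    using des unfolding hamming_design_def by auto
  have base: "\<exists>m. \<forall>w \<in> T \<rightarrow>\<^sub>E {1..q}. card {x \<in> C. restrict x T = w} = m"
      if "T \<subseteq> {1..n}" "card T = t" for T
    using des that unfolding hamming_design_def by auto
  have finC: "finite C"
    using CW by (rule finite_subset) (simp add: words_def finite_PiE)
  have split: "cnt T w = (\<Sum>a\<in>{1..q}. cnt (insert i T) (w(i := a)))"
    if "i \<in> {1..n}" "i \<notin> T" for i T w
  proof -
    have "x i \<in> {1..q}" if "x \<in> C" for x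
      using that CW \<open>i \<in> {1..n}\<close> unfolding words_def by (meson PiE_mem subsetD)
    then have "{x \<in> C. \<forall>j\<in>T. x j = w j} =
        (\<Union>a\<in>{1..q}. {x \<in> C. \<forall>j\<in>insert i T. x j = (w(i := a)) j})"
      using that(2) by (auto split: if_splits)
    moreover have "card (\<Union>a\<in>{1..q}. {x \<in> C. \<forall>j\<in>insert i T. x j = (w(i := a)) j}) =
        (\<Sum>a\<in>{1..q}. cnt (insert i T) (w(i := a)))"
      unfolding cnt_def using finC by (intro card_UN_disjoint) auto
    ultimately show ?thesis
      by (simp add: cnt_def)
  qed
  have const: "\<exists>m. \<forall>w. (\<forall>i\<in>T. w i \<in> {1..q}) \<longrightarrow> cnt T w = m"
    if "T \<subseteq> {1..n}" "card T + d = t" for T d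
    using that
  proof (induction d arbitrary: T)
    case 0
    then obtain m where m: "\<And>w. w \<in> T \<rightarrow>\<^sub>E {1..q} \<Longrightarrow> card {x \<in> C. restrict x T = w} = m"
      using base[of T] by auto
    have "cnt T w = m" if "\<forall>i\<in>T. w i \<in> {1..q}" for w
    proof -
      have "{x \<in> C. restrict x T = restrict w T} = {x \<in> C. \<forall>i\<in>T. x i = w i}"
        by (auto simp: restrict_def fun_eq_iff)
      moreover have "restrict w T \<in> T \<rightarrow>\<^sub>E {1..q}"
        using that by auto
      ultimately show ?thesis
        using m[of "restrict w T"] by (simp add: cnt_def)
    qed
    then show ?case
      by blast
  next
    case (Suc d)
    have fT: "finite T"
      using Suc.prems(1) finite_subset by blast
    \<comment> \<open>Here \<open>card T < t \<le> n\<close>, so a further coordinate is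
      available.\<close>
    have "T \<noteq> {1..n}"
      using Suc.prems tn by auto
    then obtain i where i: "i \<in> {1..n}" "i \<notin> T"
      using Suc.prems(1) by blast
    then obtain m where m: "\<And>w. (\<forall>j\<in>insert i T. w j \<in> {1..q}) \<Longrightarrow> cnt (insert i T) w = m"
      using Suc.IH[of "insert i T"] Suc.prems fT by auto
    have "cnt T w = q * m" if "\<forall>j\<in>T. w j \<in> {1..q}" for w
    proof -
      have "cnt T w = (\<Sum>a\<in>{1..q}. m)"
        unfolding split[OF i] using that by (intro sum.cong refl m) auto
      then show ?thesis
        by simp
    qed
    then show ?case
      by blast
  qed
  have "finite T"
    using T(1) finite_subset by blast
  then have "q ^ card T * cnt T w = card C"
    using T w
  proof (induction T rule: finite_induct)
    case empty
    then show ?case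
      by (simp add: cnt_def)
  next
    case (insert i T)
    have i: "i \<in> {1..n}"
      using insert.prems by simp
    obtain m where m: "\<And>w. (\<forall>j\<in>insert i T. w j \<in> {1..q}) \<Longrightarrow> cnt (insert i T) w = m"
      using const[of "insert i T" "t - card (insert i T)"] insert.prems by auto
    have "cnt T w = (\<Sum>a\<in>{1..q}. m)"
      unfolding split[OF i insert.hyps(2)] using insert.prems by (intro sum.cong refl m) auto
    moreover have "cnt (insert i T) w = m"
      using insert.prems by (intro m) auto
    moreover have "q ^ card T * cnt T w = card C"
      using insert by simp
    ultimately show ?case
      using insert.hyps by (simp add: ac_simps)
  qed
  then show ?thesis
    by (simp add: cnt_def)
qed

text \<open>Turns non-tightness of \<open>C\<close> into the condition on
  \<open>card X = card C / q\<close>, where the sum on the right is the bound for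
  \<open>n - 1\<close> coordinates. Induction on \<open>s - 1\<close> with Pascal's rule.\<close>

lemma tight_bound_eq:
  fixes n q s :: nat
  assumes "n \<ge> 1" "q \<ge> 1" "s \<ge> 1"
  shows "(\<Sum>k = 0..s - 1. (n choose k) * (q - 1) ^ k) + ((n - 1) choose (s - 1)) * (q - 1) ^ s =
    q * (\<Sum>k<s. ((n - 1) choose k) * (q - 1) ^ k)"
proof -
  obtain m p r where [simp]: "n = Suc m" "q = Suc p" "s = Suc r"
    using assms by (metis One_nat_def Suc_le_D)
  have "(\<Sum>k\<le>r. (Suc m choose k) * p ^ k) + (m choose r) * p ^ Suc r = Suc p * (\<Sum>k\<le>r. (m choose k) * p ^ k)"
    by (induction r) (simp_all add: algebra_simps)
  then show ?thesis
    by (simp add: atMost_atLeast0 lessThan_Suc_atMost del: power_Suc)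
qed

lemma prod_pairs_eq:
  fixes f :: "nat \<Rightarrow> nat \<Rightarrow> 'a::comm_monoid_mult"
  shows "(\<Prod>(i, j) \<in> {(i, j). 1 \<le> i \<and> i < j \<and> j \<le> s}. f i j) = (\<Prod>v<s. \<Prod>w<v. f (Suc w) (Suc v))"
proof -
  have "(\<Prod>v<s. \<Prod>w<v. f (Suc w) (Suc v)) = (\<Prod>(v, w)\<in>(SIGMA v:{..<s}. {..<v}). f (Suc w) (Suc v))"
    by (rule prod.Sigma) auto
  also have "\<dots> = (\<Prod>(i, j) \<in> {(i, j). 1 \<le> i \<and> i < j \<and> j \<le> s}. f i j)"
    by (rule prod.reindex_bij_witness[where i = "\<lambda>(i, j). (j - 1, i - 1)" and j = "\<lambda>(v, w). (Suc w, Suc v)"])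
       auto
  finally show ?thesis ..
qed

section \<open>Application to the words with first letter 1\<close>

theorem theoremB5:
  fixes n q s :: nat and C :: "(nat \<Rightarrow> nat) set" and \<alpha> :: "nat \<Rightarrow> nat"
  assumes "n \<ge> 2" and "q \<ge> 2" and "s \<ge> 1"
    and "hamming_design n q (2 * s - 1) C"
    and "code_degree n C = s"
    and "\<not> tight_odd_design n q s C"
    and "degree_set n C = \<alpha> ` {1..s}"
  shows "\<exists>k::int.
    real q ^ s *
      (real q ^ (s * (s - 1) div 2) *
         (\<Prod>(i, j) \<in> {(i, j). 1 \<le> i \<and> i < j \<and> j \<le> s}. real (\<alpha> i) - real (\<alpha> j)) /
       (\<Prod>i = 1..s - 1. fact i)) ^ 2 = real_of_int k \<and>
    k dvd int (card C) ^ (2 * s)"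
proof -
  define X where "X = {x \<in> C. x 1 = 1}"
  define b where "b l = \<alpha> (Suc l)" for l
  have CW: "C \<subseteq> words n q" and C_ne: "C \<noteq> {}" and sn: "2 * s - 1 \<le> n"
    using assms(4) by (auto simp: hamming_design_def)
  have finC: "finite C"
    using CW by (rule finite_subset) (simp add: words_def finite_PiE)
  have card_C: "card C = q * card X"
    using hamming_design_count[OF assms(4), of "{1}" "\<lambda>_. 1"] assms(1-3) by (simp add: X_def)
  interpret hamming_code "{2..n}" X "{1..q}" q s
  proof
    show "X \<noteq> {}"
      using card_C C_ne finC by (metis card.empty card_0_eq mult_0_right)
    show "x i \<in> {1..q}" if "x \<in> X" "i \<in> {2..n}" for x i
    proof -
      have "x \<in> {1..n} \<rightarrow>\<^sub>E {1..q}" "i \<in> {1..n}"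
        using that CW by (auto simp: X_def words_def)
      then show ?thesis
        by (rule PiE_mem)
    qed
    show "x = y" if "x \<in> X" "y \<in> X" "\<And>i. i \<in> {2..n} \<Longrightarrow> x i = y i" for x y
    proof (rule PiE_ext)
      show "x \<in> {1..n} \<rightarrow>\<^sub>E {1..q}" "y \<in> {1..n} \<rightarrow>\<^sub>E {1..q}"
        using that CW by (auto simp: X_def words_def)
      show "x i = y i" if "i \<in> {1..n}" for i
        using that \<open>x \<in> X\<close> \<open>y \<in> X\<close> \<open>\<And>i. i \<in> {2..n} \<Longrightarrow> x i = y i\<close>
        by (cases "i = 1") (auto simp: X_def)
    qed
    show "q ^ card T * card {x \<in> X. \<forall>i\<in>T. x i = w i} = card X"
      if T: "T \<subseteq> {2..n}" "card T \<le> 2 * s - 2" and w: "\<And>i. i \<in> T \<Longrightarrow> w i \<in> {1..q}" for T w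
    proof -
      have fT: "finite T" "1 \<notin> T"
        using T(1) finite_subset by auto
      \<comment> \<open>Adding coordinate 1 uses up one unit of the strength
        \<open>2 * s - 1\<close>; the extra factor \<open>q\<close> cancels against
        \<open>card C = q * card X\<close>.\<close>
      have "q ^ card (insert 1 T) * card {x \<in> C. \<forall>i\<in>insert 1 T. x i = (w(1 := 1)) i} = card C"
        using T w fT assms(1-3) by (intro hamming_design_count[OF assms(4)]) auto
      moreover have "{x \<in> C. \<forall>i\<in>insert 1 T. x i = (w(1 := 1)) i} = {x \<in> X. \<forall>i\<in>T. x i = w i}"
        using fT by (auto simp: X_def)
      ultimately show ?thesis
        using fT assms(2) by (simp add: card_C)
    qed
  qed (use assms sn finC in \<open>auto simp: X_def\<close>)
  have image_b: "b ` {..<s} = degree_set n C"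
  proof -
    have "b ` {..<s} = \<alpha> ` Suc ` {..<s}"
      by (auto simp: b_def)
    then show ?thesis
      by (simp add: assms(7) image_Suc_lessThan)
  qed
  have inj: "inj_on b {..<s}"
    using assms(5) image_b by (intro eq_card_imp_inj_on) (auto simp: code_degree_def)
  have b_pos: "b l \<noteq> 0" if "l < s" for l
  proof -
    have "b l \<in> degree_set n C"
      using that image_b by blast
    then obtain x y where xy: "x \<in> C" "y \<in> C" "x \<noteq> y" "b l = hamming_dist n x y"
      by (auto simp: degree_set_def)
    then have "\<exists>i\<in>{1..n}. x i \<noteq> y i"
      using CW unfolding words_def by (meson PiE_ext subsetD)
    then show ?thesis
      using xy by (auto simp: hamming_dist_def)
  qed
  have dists: "hdist x y \<in> b ` {..<s}" if "x \<in> X" "y \<in> X" "x \<noteq> y" for x y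
  proof -
    \<comment> \<open>Both words start with 1, so dropping that coordinate preserves their
      distance.\<close>
    have "{i \<in> {2..n}. x i \<noteq> y i} = {i \<in> {1..n}. x i \<noteq> y i}"
      using that by (auto simp: X_def Suc_le_eq numeral_2_eq_2 le_eq_less_or_eq)
    then have "hdist x y = hamming_dist n x y"
      by (simp add: hdist_def hamming_dist_def)
    then show ?thesis
      using that unfolding image_b degree_set_def by (auto simp: X_def)
  qed
  have "card X \<noteq> (\<Sum>k<s. (card {2..n} choose k) * (q - 1) ^ k)"
    using assms(1-4,6) tight_bound_eq[of n q s] by (auto simp: tight_odd_design_def card_C)
  from krawtchouk_det_dvd[OF inj b_pos dists this] obtain d :: int
    where d: "of_int d = det (mat s s (\<lambda>(k, l). K k (b l)))" and dvd: "d dvd int (card X) ^ s"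
    by blast
  let ?P = "\<Prod>v<s. \<Prod>w<v. int (b w) - int (b v)"
  \<comment> \<open>Clearing the factorials leaves an identity of integers, which transfers from the
    rationals to the reals.\<close>
  have "rat_of_int (d * (\<Prod>k<s. fact k)) = of_int (int q ^ (\<Sum>k<s. k) * ?P)"
    unfolding of_int_mult d det_krawtchouk by (simp add: prod_dividef power_sum)
  then have "d * (\<Prod>k<s. fact k) = int q ^ (\<Sum>k<s. k) * ?P"
    by (simp only: of_int_eq_iff)
  then have "real_of_int (d * (\<Prod>k<s. fact k)) = of_int (int q ^ (\<Sum>k<s. k) * ?P)"
    by (simp only:)
  moreover have "(\<Sum>k<s. k) = s * (s - 1) div 2"
    by (simp add: lessThan_atLeast0 Sum_Ico_nat)
  moreover have "(\<Prod>k<s. fact k :: real) = (\<Prod>i = 1..s - 1. fact i)"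
  proof -
    have "{..<s} = insert 0 {1..s - 1}"
      using assms(3) by auto
    then show ?thesis
      by simp
  qed
  moreover have "real_of_int ?P =
      (\<Prod>(i, j) \<in> {(i, j). 1 \<le> i \<and> i < j \<and> j \<le> s}. real (\<alpha> i) - real (\<alpha> j))"
    unfolding prod_pairs_eq b_def by simp
  ultimately have "real_of_int d * (\<Prod>i = 1..s - 1. fact i) = real q ^ (s * (s - 1) div 2) *
      (\<Prod>(i, j) \<in> {(i, j). 1 \<le> i \<and> i < j \<and> j \<le> s}. real (\<alpha> i) - real (\<alpha> j))"
    by simp
  then have "real q ^ (s * (s - 1) div 2) *
      (\<Prod>(i, j) \<in> {(i, j). 1 \<le> i \<and> i < j \<and> j \<le> s}. real (\<alpha> i) - real (\<alpha> j)) /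
      (\<Prod>i = 1..s - 1. fact i) = of_int d"
    by (simp add: divide_eq_eq)
  then have "real q ^ s *
      (real q ^ (s * (s - 1) div 2) *
         (\<Prod>(i, j) \<in> {(i, j). 1 \<le> i \<and> i < j \<and> j \<le> s}. real (\<alpha> i) - real (\<alpha> j)) /
       (\<Prod>i = 1..s - 1. fact i)) ^ 2 = real_of_int (int q ^ s * d ^ 2)"
    by simp
  moreover have "int q ^ s * d ^ 2 dvd int (card C) ^ (2 * s)"
  proof -
    \<comment> \<open>Since \<open>card C = q * card X\<close>, the target power is the right side
      here; \<open>q ^ s\<close> divides the first factor and \<open>d ^ 2\<close> the
      second.\<close>
    have "int q ^ s * d ^ 2 dvd int q ^ (2 * s) * (int (card X) ^ s) ^ 2"
      using dvd by (intro mult_dvd_mono dvd_power_same le_imp_power_dvd) auto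
    then show ?thesis
      by (simp add: card_C power_mult_distrib power_mult[symmetric] mult.commute)
  qed
  ultimately show ?thesis
    by blast
qed

end
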